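(* Let $G$ be a finite simple connected graph and let $x\in V(G)$. If $G$ is upper-critical, then $G-x$ is also upper-critical.
   Context: $G-x$ is the graph obtained from $G$ by deleting the vertex $x$ and all edges incident with it. $\chi(G)$ is the chromatic number. $\overline{G}$ is the complement of $G$, and for $e\in E(\overline{G})$, $G+e$ is $G$ with the edge $e$ added. A finite simple graph $G$ is upper-critical if no edge can be added to it while preserving its chromatic number, i.e. $\{e\in E(\overline{G}) : \chi(G+e)=\chi(G)\}=\emptyset$ (equivalently, $\chi(G+e)>\chi(G)$ for all $e\in E(\overline{G})$; in particular every complete graph is upper-critical). This definition is applied to $G-x$ whether or not it is connected. *)

theory Defs
  imports "Graph_Theory.Digraph_Component"
begin

text \<open>
  Finite simple graphs are represented by \<^locale>\<open>pair_graph\<close>: an undirected edge between \<open>u\<close> and \<open>v\<close>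
  is the pair of arcs \<open>(u, v)\<close> and \<open>(v, u)\<close>, so there are no loops and no parallel edges.
\<close>

definition del_vertex :: "'a pair_pre_digraph \<Rightarrow> 'a \<Rightarrow> 'a pair_pre_digraph" where
  "del_vertex G x = \<lparr> pverts = pverts G - {x},
                     parcs = {e \<in> parcs G. fst e \<noteq> x \<and> snd e \<noteq> x} \<rparr>"

lemma with_proj_del_vertex:
  "with_proj (del_vertex G x) = pre_digraph.del_vert (with_proj G) x"
  by (simp add: del_vertex_def with_proj_def pre_digraph.del_vert_def)

definition complement_graph :: "'a pair_pre_digraph \<Rightarrow> 'a pair_pre_digraph" where
  "complement_graph G = \<lparr> pverts = pverts G,
     parcs = {(u, v). u \<in> pverts G \<and> v \<in> pverts G \<and> u \<noteq> v \<and> (u, v) \<notin> parcs G} \<rparr>"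

text \<open>Both orientations of the new edge are added, so that the result is again undirected.\<close>

definition add_edge :: "'a pair_pre_digraph \<Rightarrow> 'a \<times> 'a \<Rightarrow> 'a pair_pre_digraph" where
  "add_edge G e = \<lparr> pverts = pverts G, parcs = parcs G \<union> {e, prod.swap e} \<rparr>"

definition proper_coloring :: "'a pair_pre_digraph \<Rightarrow> nat \<Rightarrow> ('a \<Rightarrow> nat) \<Rightarrow> bool" where
  "proper_coloring G k c \<longleftrightarrow>
     (\<forall>v \<in> pverts G. c v < k) \<and> (\<forall>(u, v) \<in> parcs G. c u \<noteq> c v)"

definition chromatic_number :: "'a pair_pre_digraph \<Rightarrow> nat" where
  "chromatic_number G = (LEAST k. \<exists>c. proper_coloring G k c)"

definition upper_critical :: "'a pair_pre_digraph \<Rightarrow> bool" where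
  "upper_critical G \<longleftrightarrow>
     {e \<in> parcs (complement_graph G). chromatic_number (add_edge G e) = chromatic_number G} = {}"

lemma pair_graph_del_vertex:
  assumes "pair_graph G"
  shows "pair_graph (del_vertex G x)"
proof -
  interpret pair_graph G by fact
  show ?thesis
    by unfold_locales
      (auto simp: del_vertex_def symmetric_def sym_def pair_finite_verts pair_finite_arcs
        intro: arcs_symmetric in_arcsD1 in_arcsD2 dest: no_loops')
qed

lemma pair_graph_complement_graph:
  assumes "pair_graph G"
  shows "pair_graph (complement_graph G)"
proof -
  interpret pair_graph G by fact
  have "finite (parcs (complement_graph G))"
    by (rule finite_subset[of _ "pverts G \<times> pverts G"])
      (auto simp: complement_graph_def pair_finite_verts)
  then show ?thesis
    by unfold_locales
      (auto simp: complement_graph_def symmetric_def sym_def pair_finite_verts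
        intro: arcs_symmetric)
qed

lemma pair_graph_add_edge:
  assumes "pair_graph G" and "e \<in> parcs (complement_graph G)"
  shows "pair_graph (add_edge G e)"
proof -
  interpret pair_graph G by fact
  show ?thesis
    using assms(2)
    by unfold_locales
      (auto simp: add_edge_def complement_graph_def symmetric_def sym_def
        pair_finite_verts pair_finite_arcs
        intro: arcs_symmetric in_arcsD1 in_arcsD2 dest: no_loops')
qed

lemma proper_coloring_chromatic_number:
  assumes "pair_graph G"
  shows "\<exists>c. proper_coloring G (chromatic_number G) c"
proof -
  interpret pair_graph G by fact
  obtain c :: "'a \<Rightarrow> nat" and n where c: "c ` pverts G = {i. i < n}" "inj_on c (pverts G)"
    using finite_imp_inj_to_nat_seg[OF pair_finite_verts] by blast
  have "c u \<noteq> c v" if "(u, v) \<in> parcs G" for u v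
    using that c(2) in_arcsD1 in_arcsD2 no_loops' by (metis inj_onD)
  moreover have "\<forall>v \<in> pverts G. c v < n"
    using c(1) by blast
  ultimately have "proper_coloring G n c"
    by (auto simp: proper_coloring_def)
  then have "\<exists>k c. proper_coloring G k c"
    by blast
  then show ?thesis
    unfolding chromatic_number_def by (rule LeastI_ex)
qed

end

theory Submission
  imports Defs
begin

text \<open>
  The reason is structural: upper-critical graphs are exactly the complete multipartite graphs, and
  deleting a vertex from a complete multipartite graph leaves a complete multipartite graph.

  If two non-adjacent vertices had different colours in an optimal colouring, that colouring would
  survive the addition of the edge between them. So upper-criticality forces adjacency to coincide
  with having different colours (\<open>upper_critical_imp_complete_multipartite\<close>). Conversely, a complete
  multipartite graph with \<open>p\<close> parts is \<open>p\<close>-colourable, but an edge added inside one part, together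
  with one vertex from each of the other parts, spans a clique on \<open>p + 1\<close> vertices
  (\<open>complete_multipartite_imp_upper_critical\<close>).
\<close>

text \<open>
  The parts are the fibres of a function \<open>c\<close> on the vertices, so that the parts of an induced
  subgraph are given by the same function.
\<close>

definition complete_multipartite :: "'a pair_pre_digraph \<Rightarrow> ('a \<Rightarrow> nat) \<Rightarrow> bool" where
  "complete_multipartite G c \<longleftrightarrow>
     (\<forall>u \<in> pverts G. \<forall>v \<in> pverts G. (u, v) \<in> parcs G \<longleftrightarrow> c u \<noteq> c v)"

lemma chromatic_number_le:
  assumes "proper_coloring G k c"
  shows "chromatic_number G \<le> k"
  unfolding chromatic_number_def using assms by (intro Least_le exI)

lemma proper_coloring_add_edge_iff:
  "proper_coloring (add_edge G (u, v)) k c \<longleftrightarrow> proper_coloring G k c \<and> c u \<noteq> c v"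
  by (auto simp: proper_coloring_def add_edge_def)

lemma chromatic_number_le_add_edge:
  assumes "pair_graph G" and "(u, v) \<in> parcs (complement_graph G)"
  shows "chromatic_number G \<le> chromatic_number (add_edge G (u, v))"
  using proper_coloring_chromatic_number[OF pair_graph_add_edge[OF assms]]
  by (auto simp: proper_coloring_add_edge_iff intro: chromatic_number_le)

lemma upper_critical_imp_complete_multipartite:
  assumes G: "pair_graph G" and crit: "upper_critical G"
  obtains c where "complete_multipartite G c"
proof -
  obtain c where c: "proper_coloring G (chromatic_number G) c"
    using proper_coloring_chromatic_number[OF G] by blast
  have "(u, v) \<in> parcs G"
    if "u \<in> pverts G" "v \<in> pverts G" "c u \<noteq> c v" for u v
  proof (rule ccontr)
    assume "(u, v) \<notin> parcs G"
    with that have e: "(u, v) \<in> parcs (complement_graph G)"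
      by (auto simp: complement_graph_def)
    have "chromatic_number (add_edge G (u, v)) \<le> chromatic_number G"
      using c that(3) by (intro chromatic_number_le) (simp add: proper_coloring_add_edge_iff)
    with chromatic_number_le_add_edge[OF G e]
    have "chromatic_number (add_edge G (u, v)) = chromatic_number G"
      by simp
    with e crit show False
      unfolding upper_critical_def by blast
  qed
  with c have "complete_multipartite G c"
    by (auto simp: complete_multipartite_def proper_coloring_def)
  then show thesis ..
qed

text \<open>The parts, numbered from \<open>0\<close>, serve as colour classes.\<close>

lemma chromatic_number_complete_multipartite_le:
  assumes G: "pair_graph G" and c: "complete_multipartite G c"
  shows "chromatic_number G \<le> card (c ` pverts G)"
proof -
  interpret pair_graph G by fact
  obtain h where h: "bij_betw h (c ` pverts G) {0..<card (c ` pverts G)}"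
    using ex_bij_betw_finite_nat[of "c ` pverts G"] pair_finite_verts by auto
  have "h (c v) < card (c ` pverts G)" if "v \<in> pverts G" for v
    using bij_betwE[OF h] that by simp
  moreover have "h (c u) \<noteq> h (c v)" if "(u, v) \<in> parcs G" for u v
    using that c in_arcsD1[OF that] in_arcsD2[OF that] bij_betw_imp_inj_on[OF h]
    by (auto simp: complete_multipartite_def dest: inj_onD)
  ultimately have "proper_coloring G (card (c ` pverts G)) (h \<circ> c)"
    by (auto simp: proper_coloring_def)
  then show ?thesis
    by (rule chromatic_number_le)
qed

lemma clique_card_le_chromatic_number:
  assumes "pair_graph G" and "S \<subseteq> pverts G"
    and clique: "\<And>u v. u \<in> S \<Longrightarrow> v \<in> S \<Longrightarrow> u \<noteq> v \<Longrightarrow> (u, v) \<in> parcs G"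
  shows "card S \<le> chromatic_number G"
proof -
  obtain d where d: "proper_coloring G (chromatic_number G) d"
    using proper_coloring_chromatic_number[OF assms(1)] by blast
  then have "inj_on d S"
    using clique by (fastforce simp: proper_coloring_def inj_on_def)
  moreover have "d ` S \<subseteq> {..<chromatic_number G}"
    using d assms(2) by (auto simp: proper_coloring_def)
  ultimately show ?thesis
    using card_inj_on_le[of d S "{..<chromatic_number G}"] by simp
qed

lemma complete_multipartite_imp_upper_critical:
  assumes G: "pair_graph G" and c: "complete_multipartite G c"
  shows "upper_critical G"
proof -
  interpret pair_graph G by fact
  have "chromatic_number G < chromatic_number (add_edge G (u, v))"
    if e: "(u, v) \<in> parcs (complement_graph G)" for u v
  proof -
    from e c have uv: "u \<in> pverts G" "v \<in> pverts G" "u \<noteq> v" "c u = c v"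
      by (auto simp: complement_graph_def complete_multipartite_def)
    let ?P = "c ` pverts G"
    \<comment> \<open>\<open>r\<close> picks a vertex from each part, and picks \<open>u\<close> from the part that contains \<open>u\<close> and \<open>v\<close>;
        thus adding \<open>v\<close> to its range gives one more vertex, joined to \<open>u\<close> by the new edge.\<close>
    define r where "r = (inv_into (pverts G) c)(c u := u)"
    have r: "r a \<in> pverts G" "c (r a) = a" if "a \<in> ?P" for a
      using that uv(1) by (auto simp: r_def inv_into_into f_inv_into_f)
    have ru: "r (c u) = u"
      by (simp add: r_def)
    let ?S = "insert v (r ` ?P)"
    have "inj_on r ?P"
      using r(2) by (rule inj_on_inverseI)
    then have "card (r ` ?P) = card ?P"
      by (rule card_image)
    moreover have "v \<notin> r ` ?P"
      using r(2) ru uv by force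
    ultimately have "card ?S = Suc (card ?P)"
      using pair_finite_verts by simp
    moreover have "card ?S \<le> chromatic_number (add_edge G (u, v))"
    proof (rule clique_card_le_chromatic_number[OF pair_graph_add_edge[OF G e]])
      show S: "?S \<subseteq> pverts (add_edge G (u, v))"
        using r(1) uv(2) by (auto simp: add_edge_def)
      fix y z
      assume yz: "y \<in> ?S" "z \<in> ?S" "y \<noteq> z"
      show "(y, z) \<in> parcs (add_edge G (u, v))"
      proof (cases "c y = c z")
        case True
        have "w = v \<or> w = r (c w)" if "w \<in> ?S" for w
          using that r(2) by auto
        with yz True ru uv(4) have "(y, z) = (u, v) \<or> (y, z) = (v, u)"
          by metis
        then show ?thesis
          by (auto simp: add_edge_def)
      next
        case False
        moreover have "y \<in> pverts G" "z \<in> pverts G"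
          using yz(1,2) S by (auto simp: add_edge_def)
        ultimately have "(y, z) \<in> parcs G"
          using c by (simp add: complete_multipartite_def)
        then show ?thesis
          by (simp add: add_edge_def)
      qed
    qed
    ultimately show ?thesis
      using chromatic_number_complete_multipartite_le[OF G c] by simp
  qed
  then show ?thesis
    unfolding upper_critical_def by fastforce
qed

lemma complete_multipartite_del_vertex:
  assumes "complete_multipartite G c"
  shows "complete_multipartite (del_vertex G x) c"
  using assms by (auto simp: complete_multipartite_def del_vertex_def)

theorem theorem6:
  fixes G :: "'a pair_pre_digraph" and x :: 'a
  assumes "pair_graph G"
    and "Digraph_Component.connected (with_proj G)"
    and "x \<in> pverts G"
    and "upper_critical G"
  shows "upper_critical (del_vertex G x)"
proof -
  obtain c where "complete_multipartite G c"
    using upper_critical_imp_complete_multipartite[OF assms(1,4)] .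
  then have "complete_multipartite (del_vertex G x) c"
    by (rule complete_multipartite_del_vertex)
  with pair_graph_del_vertex[OF assms(1)] show ?thesis
    by (rule complete_multipartite_imp_upper_critical)
qed

end
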